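(* Let $R$ be a lattice-ordered division ring (not assumed commutative). Then the following statements are equivalent: $(\alpha)$ $a^2\geq 0$ for all $a\in R$. $(\beta)$ $R$ is order division-closed, that is, for all $a,b\in R$, if $ab>0$ and one of $a,b$ is $>0$, then so is the other. $(\gamma)$ $R$ is totally ordered. $(\delta)$ For every $a\in R$ there exists a natural number $n_a\geq 1$ such that $a^{n_a}\geq 0$. $(\epsilon)$ $R$ is an $f$-ring, that is, for all $a,b,c\in R$, $a\wedge b=0$ and $c\geq 0$ imply $ca\wedge b=ac\wedge b=0$. $(\zeta)$ $R$ is an almost $f$-ring, that is, for all $a,b\in R$, $a\wedge b=0$ implies $ab=0$. $(\lambda)$ The additive group of $R$, with its given order, is (isomorphic as a partially ordered group to) the group of divisibility of a valuation domain. $(\eta)$ Each strictly positive element of $R$ has a strictly positive multiplicative inverse.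
   Context: A lattice-ordered division ring is a division ring $R$ (not necessarily commutative) with a partial order $\leq$ that is a lattice order (with meet $\wedge$ and join $\vee$), such that $a\leq b$ implies $a+c\leq b+c$ for all $a,b,c\in R$, and $a\geq 0$, $b\geq 0$ imply $ab\geq 0$. It is not assumed that $1>0$. An element $a$ is strictly positive if $a>0$. Expressions such as $ca\wedge b$ mean $(ca)\wedge b$. The group of divisibility of an integral domain $D$ with quotient field $K$ is the group $K^*/U(D)$, where $K^*=K\setminus\{0\}$ and $U(D)$ is the group of units of $D$, partially ordered by $xU(D)\leq yU(D)$ if and only if $yx^{-1}\in D$. A valuation domain is an integral domain $D$ such that for every nonzero $x$ in its quotient field, $x\in D$ or $x^{-1}\in D$. *)

theory Defs
  imports "HOL-Library.Lattice_Algebras" "HOL-Algebra.Algebra"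
begin

text \<open>
  Multiplication need not be commutative, and \<open>0 < 1\<close> is not assumed.  In a ring whose
  order is translation invariant, the two monotonicity axioms of \<^class>\<open>ordered_ring\<close> are
  equivalent to \<open>0 \<le> a \<Longrightarrow> 0 \<le> b \<Longrightarrow> 0 \<le> a * b\<close>.
\<close>

class lattice_ordered_division_ring = division_ring + ordered_ring + lattice_ab_group_add

definition tfae :: "bool list \<Rightarrow> bool" where
  "tfae Ps \<longleftrightarrow> (\<forall>P\<in>set Ps. \<forall>Q\<in>set Ps. P \<longleftrightarrow> Q)"

definition additive_group :: "'a::ab_group_add monoid" where
  "additive_group = \<lparr>carrier = UNIV, monoid.mult = (+), one = 0\<rparr>"

text \<open>
  An integral domain is presented together with its quotient field: \<open>D\<close> is a subset of the
  carrier of \<open>K\<close> and carries the operations of \<open>K\<close>.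
\<close>

definition quotient_field :: "('k, 'm) ring_scheme \<Rightarrow> 'k set \<Rightarrow> bool" where
  "quotient_field K D \<longleftrightarrow> field K \<and> subdomain D K \<and>
     (\<forall>x\<in>carrier K. \<exists>a\<in>D. \<exists>b\<in>D - {\<zero>\<^bsub>K\<^esub>}. x = a \<otimes>\<^bsub>K\<^esub> inv\<^bsub>K\<^esub> b)"

definition valuation_domain :: "('k, 'm) ring_scheme \<Rightarrow> 'k set \<Rightarrow> bool" where
  "valuation_domain K D \<longleftrightarrow> quotient_field K D \<and>
     (\<forall>x\<in>carrier K - {\<zero>\<^bsub>K\<^esub>}. x \<in> D \<or> inv\<^bsub>K\<^esub> x \<in> D)"

definition domain_units :: "('k, 'm) ring_scheme \<Rightarrow> 'k set \<Rightarrow> 'k set" where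
  "domain_units K D = Units (K\<lparr>carrier := D\<rparr>)"

definition divisibility_group :: "('k, 'm) ring_scheme \<Rightarrow> 'k set \<Rightarrow> 'k set monoid" where
  "divisibility_group K D = mult_of K Mod domain_units K D"

definition divisibility_le :: "('k, 'm) ring_scheme \<Rightarrow> 'k set \<Rightarrow> 'k set \<Rightarrow> 'k set \<Rightarrow> bool" where
  "divisibility_le K D A B \<longleftrightarrow>
     (\<exists>x\<in>carrier (mult_of K). \<exists>y\<in>carrier (mult_of K).
        A = domain_units K D #>\<^bsub>mult_of K\<^esub> x \<and>
        B = domain_units K D #>\<^bsub>mult_of K\<^esub> y \<and>
        y \<otimes>\<^bsub>K\<^esub> inv\<^bsub>K\<^esub> x \<in> D)"

text \<open>
  A formula cannot quantify over types, so the type \<open>'k\<close> in which the quotient field is sought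
  is a parameter.  Existence in some type is recovered by fixing a type that is large enough and
  proving that existence in an arbitrary type \<open>'k\<close> implies existence in the fixed one.
\<close>

definition valuation_divisibility_group ::
    "'a::{ab_group_add,ord} itself \<Rightarrow> 'k itself \<Rightarrow> bool" where
  "valuation_divisibility_group _ _ \<longleftrightarrow>
     (\<exists>(K :: 'k ring) D. valuation_domain K D \<and>
        (\<exists>\<phi>\<in>iso (additive_group :: 'a monoid) (divisibility_group K D).
           \<forall>a b. a \<le> b \<longleftrightarrow> divisibility_le K D (\<phi> a) (\<phi> b)))"

text \<open>
  A type large enough to contain, for every totally ordered abelian group on \<open>'a\<close>, a valuation
  domain with that group of divisibility: elements of the quotient field of a group algebra over
  the rationals are equivalence classes of pairs of functions \<open>'a \<Rightarrow> rat\<close>.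
\<close>

type_synonym 'a fraction_universe = "(('a \<Rightarrow> rat) \<times> ('a \<Rightarrow> rat)) set"

end

theory Submission
  imports Defs "HOL-Library.Poly_Mapping" "HOL-Algebra.Algebraic_Closure_Type"
begin

text \<open>
  Everything is compared with totality of the order.  In a lattice-ordered group, totality means
  that two disjoint elements (\<open>inf u v = 0\<close>) are never both nonzero, because \<open>a\<close> and \<open>b\<close> minus
  their meet are disjoint.  In an almost \<open>f\<close>-ring without zero divisors this is immediate, and an
  \<open>f\<close>-ring is an almost \<open>f\<close>-ring.

  The conditions on squares, powers and quotients all pass through positivity of inverses of
  positive elements: if \<open>inverse a ^ n\<close> is nonnegative for a positive \<open>a\<close>, then so is
  \<open>inverse a = a ^ (n - 1) * inverse a ^ n\<close>; and division-closure applied to \<open>a * 1\<close> and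
  \<open>a * inverse a\<close> gives \<open>0 < 1\<close> and then \<open>0 < inverse a\<close>.  If inverses of positive elements are
  positive and \<open>u\<close>, \<open>v\<close> are positive and disjoint, put \<open>c = inverse (u + v)\<close>.  Then \<open>u * c\<close> and
  \<open>v * c\<close> are positive with sum \<open>1\<close>, so each is at most \<open>1\<close> and their product lies below both.
  Cancelling \<open>c\<close> yields a positive lower bound \<open>u * c * v\<close> of \<open>u\<close> and \<open>v\<close>, a contradiction
  (\<open>total_if_positive_inverses\<close>).

  The group of divisibility of a valuation domain is totally ordered, since of \<open>x\<close> and \<open>inverse x\<close>
  one lies in the domain.  Conversely a totally ordered abelian group \<open>G\<close> is the value group of the
  quotient field of its group algebra over the rationals: the least exponent of an element of the
  group algebra is a valuation, it extends to fractions, and the fractions of nonnegative value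
  form a valuation domain.  Its units are the fractions of value zero, so the homomorphism theorem
  identifies its group of divisibility with \<open>G\<close>
  (\<open>surjective_valuation.valuation_divisibility_group\<close>).  The quotient field is finally copied
  into the prescribed type along an injection (\<open>total_group_is_divisibility_group\<close>).
\<close>

definition totally_ordered :: "'a::ord itself \<Rightarrow> bool" where
  "totally_ordered _ \<longleftrightarrow> (\<forall>a b::'a. a \<le> b \<or> b \<le> a)"

section \<open>Order conditions that force totality\<close>

text \<open>
  Subtracting the meet makes any two elements disjoint; if one difference vanishes, that element
  is the meet.
\<close>

lemma total_if_disjoint_elements_vanish:
  assumes "\<And>u v::'a. inf u v = 0 \<Longrightarrow> u = 0 \<or> v = 0"
  shows "totally_ordered TYPE('a::lattice_ab_group_add)"
  unfolding totally_ordered_def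
proof (intro allI)
  fix a b :: 'a
  have "inf (a - inf a b) (b - inf a b) = 0"
    using add_inf_distrib_right[of a b "- inf a b"] by (metis add.right_inverse diff_conv_add_uminus)
  with assms have "a = inf a b \<or> b = inf a b"
    by (metis eq_iff_diff_eq_0)
  then show "a \<le> b \<or> b \<le> a"
    by (metis inf.cobounded1 inf.cobounded2)
qed

lemma pos_mult_pos:
  fixes a b :: "'a::lattice_ordered_division_ring"
  assumes "0 < a" "0 < b"
  shows "0 < a * b"
proof -
  have "0 \<le> a * b" "a * b \<noteq> 0"
    using assms by (auto simp: less_imp_le)
  then show ?thesis
    by (simp add: less_le)
qed

text \<open>
  Positivity of \<open>1\<close> comes from the hypothesis at \<open>1\<close>.  A nonnegative power of \<open>inverse a\<close>
  can be multiplied by a power of \<open>a\<close> to leave a single factor \<open>inverse a\<close>.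
\<close>

lemma positive_inverses_if_positive_power:
  fixes a :: "'a::lattice_ordered_division_ring"
  assumes pow: "\<And>x::'a. \<exists>n::nat. 1 \<le> n \<and> 0 \<le> x ^ n" and "0 < a"
  shows "0 < inverse a"
proof -
  have one: "0 \<le> (1::'a)"
    using pow[of 1] by simp
  have nonneg: "0 \<le> a ^ m" for m
    by (induction m) (use one \<open>0 < a\<close> in \<open>auto simp: less_imp_le\<close>)
  obtain n :: nat where n: "1 \<le> n" "0 \<le> inverse a ^ n"
    using pow by blast
  then obtain m where m: "n = Suc m"
    by (cases n) auto
  have "a ^ m * inverse a ^ m = 1"
    using \<open>0 < a\<close> by (simp add: power_inverse)
  then have "inverse a = a ^ m * inverse a ^ n"
    by (simp add: m power_Suc2 mult.assoc[symmetric] del: power_Suc)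
  also have "0 \<le> \<dots>"
    using nonneg n(2) by simp
  finally show ?thesis
    using \<open>0 < a\<close> by (simp add: less_le)
qed

lemma positive_inverses_if_division_closed:
  fixes a :: "'a::lattice_ordered_division_ring"
  assumes closed: "\<And>x y::'a. 0 < x * y \<Longrightarrow> 0 < x \<Longrightarrow> 0 < y" and "0 < a"
  shows "0 < inverse a"
proof -
  have "0 < (1::'a)"
    using closed[of a 1] \<open>0 < a\<close> by simp
  then show ?thesis
    using closed[of a "inverse a"] \<open>0 < a\<close> by simp
qed

text \<open>
  The sum of two positive disjoint elements would have a positive inverse \<open>c\<close>, which splits \<open>1\<close>
  into positive parts \<open>u * c\<close> and \<open>v * c\<close>.  Elements between \<open>0\<close> and \<open>1\<close> have a product below both
  factors; cancelling \<open>c\<close> turns it into a positive common lower bound of \<open>u\<close> and \<open>v\<close>.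
\<close>

lemma total_if_positive_inverses:
  assumes inv: "\<And>x::'a. 0 < x \<Longrightarrow> 0 < inverse x"
  shows "totally_ordered TYPE('a::lattice_ordered_division_ring)"
proof (rule total_if_disjoint_elements_vanish)
  fix u v :: 'a
  assume disjoint: "inf u v = 0"
  show "u = 0 \<or> v = 0"
  proof (rule ccontr)
    assume "\<not> (u = 0 \<or> v = 0)"
    moreover have "0 \<le> u" "0 \<le> v"
      using disjoint by (metis inf.cobounded1, metis inf.cobounded2)
    ultimately have uv: "0 < u" "0 < v"
      by (auto simp: less_le)
    define c where "c = inverse (u + v)"
    have "0 < u + v"
      using uv by (simp add: add_pos_pos)
    then have c: "0 < c" "u * c + v * c = 1"
      using inv by (auto simp: c_def distrib_right[symmetric])
    have pos: "0 < u * c" "0 < v * c"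
      using uv c(1) by (auto intro: pos_mult_pos)
    then have "u * c \<le> 1" "v * c \<le> 1"
      using c(2) by (metis add_increasing2 order.refl less_imp_le, metis add_increasing order.refl less_imp_le)
    then have "(u * c * v) * c \<le> u * c" "(u * c * v) * c \<le> v * c"
      using pos mult_left_mono[of "v * c" 1 "u * c"] mult_right_mono[of "u * c" 1 "v * c"]
      by (auto simp: less_imp_le mult.assoc)
    moreover have "x \<le> y" if "x * c \<le> y * c" for x y
    proof -
      have "x * c * inverse c \<le> y * c * inverse c"
        using that inv[OF c(1)] by (simp add: mult_right_mono less_imp_le)
      then show ?thesis
        using c(1) by (simp add: mult.assoc)
    qed
    ultimately have "u * c * v \<le> u" "u * c * v \<le> v"
      by blast+
    then have "(u * c) * v \<le> 0"
      using disjoint by (metis le_inf_iff)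
    then show False
      using pos_mult_pos[OF pos(1) uv(2)] by (simp add: leD)
  qed
qed

text \<open>
  Multiplying first \<open>a\<close> by \<open>b\<close> on the right and then \<open>b\<close> by \<open>a\<close> on the left turns the two disjoint
  elements into one and the same element \<open>a * b\<close>, which is therefore disjoint from itself.
\<close>

lemma disjoint_product_zero_if_f_ring:
  fixes a b :: "'a::lattice_ordered_division_ring"
  assumes f_ring: "\<And>a b c::'a. inf a b = 0 \<Longrightarrow> 0 \<le> c \<Longrightarrow>
      inf (c * a) b = 0 \<and> inf (a * c) b = 0"
    and "inf a b = 0"
  shows "a * b = 0"
proof -
  have "0 \<le> a" "0 \<le> b"
    using \<open>inf a b = 0\<close> by (metis inf.cobounded1, metis inf.cobounded2)
  have "inf b (a * b) = 0"
    using f_ring[OF \<open>inf a b = 0\<close> \<open>0 \<le> b\<close>] by (simp add: inf.commute)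
  then have "inf (a * b) (a * b) = 0"
    using f_ring \<open>0 \<le> a\<close> by blast
  then show ?thesis
    by simp
qed

lemma total_order_consequences:
  fixes a b c :: "'a::lattice_ordered_division_ring"
  assumes "totally_ordered TYPE('a)"
  shows "0 \<le> a ^ 2"
    and "0 < a * b \<Longrightarrow> 0 < a \<or> 0 < b \<Longrightarrow> 0 < a \<and> 0 < b"
    and "inf a b = 0 \<Longrightarrow> 0 \<le> c \<Longrightarrow> inf (c * a) b = 0 \<and> inf (a * c) b = 0"
proof -
  have total: "x \<le> y \<or> y \<le> x" for x y :: 'a
    using assms by (simp add: totally_ordered_def)
  show "0 \<le> a ^ 2"
    using total[of 0 a] by (auto simp: power2_eq_square split_mult_pos_le)
  show "0 < a \<and> 0 < b" if "0 < a * b" "0 < a \<or> 0 < b"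
    using that total[of 0 a] total[of 0 b]
    by (metis less_le mult_nonneg_nonpos mult_nonpos_nonneg mult_eq_0_iff order_antisym)
  assume ab: "inf a b = 0" and c: "0 \<le> c"
  have nonneg: "0 \<le> a" "0 \<le> b"
    using ab by (metis inf.cobounded1, metis inf.cobounded2)
  have "a = 0 \<or> b = 0"
    using ab total[of a b] by (auto simp: inf_absorb1 inf_absorb2)
  then show "inf (c * a) b = 0 \<and> inf (a * c) b = 0"
    using nonneg c by (auto simp: inf_absorb1 inf_absorb2)
qed

section \<open>Valuations on group algebras and their fraction fields\<close>

text \<open>
  A valuation with the value at zero left arbitrary.  The ultrametric inequality is stated through
  lower bounds instead of minima, so that it makes sense for values in a partially ordered group.
\<close>

definition is_valuation :: "('r::ring \<Rightarrow> 'g::ordered_ab_group_add) \<Rightarrow> bool" where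
  "is_valuation v \<longleftrightarrow>
     (\<forall>x y. x \<noteq> 0 \<longrightarrow> y \<noteq> 0 \<longrightarrow> v (x * y) = v x + v y) \<and>
     (\<forall>x y c. x \<noteq> 0 \<longrightarrow> y \<noteq> 0 \<longrightarrow> x + y \<noteq> 0 \<longrightarrow> c \<le> v x \<longrightarrow> c \<le> v y \<longrightarrow> c \<le> v (x + y))"

lemma is_valuation_mult:
  "is_valuation v \<Longrightarrow> x \<noteq> 0 \<Longrightarrow> y \<noteq> 0 \<Longrightarrow> v (x * y) = v x + v y"
  by (simp add: is_valuation_def)

lemma is_valuation_add:
  "is_valuation v \<Longrightarrow> x \<noteq> 0 \<Longrightarrow> y \<noteq> 0 \<Longrightarrow> x + y \<noteq> 0 \<Longrightarrow> c \<le> v x \<Longrightarrow> c \<le> v y \<Longrightarrow> c \<le> v (x + y)"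
  by (simp add: is_valuation_def)

text \<open>
  The finitely supported functions on a group form its group algebra under convolution; the keys of
  such a function are the exponents of its terms.
\<close>

definition least_exponent :: "('g::linorder \<Rightarrow>\<^sub>0 'b::zero) \<Rightarrow> 'g" where
  "least_exponent p = Min (Poly_Mapping.keys p)"

lemma le_least_exponent_iff: "p \<noteq> 0 \<Longrightarrow> c \<le> least_exponent p \<longleftrightarrow> (\<forall>k\<in>Poly_Mapping.keys p. c \<le> k)"
  by (simp add: least_exponent_def)

lemma least_exponent_single: "b \<noteq> 0 \<Longrightarrow> least_exponent (Poly_Mapping.single g b) = g"
  by (simp add: least_exponent_def)

lemma split_off_least_exponent:
  fixes p :: "'g::linorder \<Rightarrow>\<^sub>0 'b::ab_group_add"
  assumes "p \<noteq> 0"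
  obtains b r where "b \<noteq> 0" "p = Poly_Mapping.single (least_exponent p) b + r"
    "\<And>k. k \<in> Poly_Mapping.keys r \<Longrightarrow> least_exponent p < k"
proof
  let ?g = "least_exponent p"
  let ?b = "Poly_Mapping.lookup p ?g"
  let ?r = "p - Poly_Mapping.single ?g ?b"
  have "?g \<in> Poly_Mapping.keys p"
    using assms by (simp add: least_exponent_def)
  then show "?b \<noteq> 0"
    by (simp add: in_keys_iff)
  show "p = Poly_Mapping.single ?g ?b + ?r"
    by simp
  show "?g < k" if "k \<in> Poly_Mapping.keys ?r" for k
  proof -
    have nonzero: "Poly_Mapping.lookup ?r k \<noteq> 0"
      using that by (simp add: in_keys_iff)
    then have "k \<noteq> ?g"
      by (auto simp: lookup_minus)
    moreover from this have "k \<in> Poly_Mapping.keys p"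
      using nonzero by (simp add: lookup_minus lookup_single_not_eq in_keys_iff)
    ultimately show ?thesis
      using le_least_exponent_iff[OF assms, of ?g] by (simp add: less_le)
  qed
qed

text \<open>
  The product of the two lowest terms has a nonzero coefficient, and every other term of the
  product has a strictly larger exponent, so nothing can cancel it.
\<close>

lemma least_exponent_mult:
  fixes p q :: "'g::linordered_ab_group_add \<Rightarrow>\<^sub>0 'b::idom"
  assumes "p \<noteq> 0" "q \<noteq> 0"
  shows "least_exponent (p * q) = least_exponent p + least_exponent q"
proof -
  let ?m = "least_exponent p" and ?n = "least_exponent q"
  obtain b r where p: "b \<noteq> 0" "p = Poly_Mapping.single ?m b + r" "\<And>k. k \<in> Poly_Mapping.keys r \<Longrightarrow> ?m < k"
    using split_off_least_exponent[OF assms(1)] by blast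
  obtain c s where q: "c \<noteq> 0" "q = Poly_Mapping.single ?n c + s" "\<And>k. k \<in> Poly_Mapping.keys s \<Longrightarrow> ?n < k"
    using split_off_least_exponent[OF assms(2)] by blast
  define t where "t = Poly_Mapping.single ?m b * s + r * q"
  have "p * q = Poly_Mapping.single ?m b * q + r * q"
    using p(2) by (metis distrib_right)
  also have "Poly_Mapping.single ?m b * q = Poly_Mapping.single ?m b * (Poly_Mapping.single ?n c + s)"
    using q(2) by metis
  finally have pq: "p * q = Poly_Mapping.single (?m + ?n) (b * c) + t"
    by (simp add: t_def distrib_left mult_single add.assoc)
  have ge: "?n \<le> k" if "k \<in> Poly_Mapping.keys q" for k
    using that le_least_exponent_iff[OF assms(2), of ?n] by simp
  have t: "?m + ?n < k" if "k \<in> Poly_Mapping.keys t" for k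
  proof -
    have "k \<in> Poly_Mapping.keys (Poly_Mapping.single ?m b * s) \<or> k \<in> Poly_Mapping.keys (r * q)"
      using that keys_add[of "Poly_Mapping.single ?m b * s" "r * q"] unfolding t_def by blast
    then show ?thesis
    proof
      assume "k \<in> Poly_Mapping.keys (Poly_Mapping.single ?m b * s)"
      then obtain j where "j \<in> Poly_Mapping.keys s" "k = ?m + j"
        using keys_mult[of "Poly_Mapping.single ?m b" s] by (auto split: if_splits)
      then show ?thesis
        using q(3) by simp
    next
      assume "k \<in> Poly_Mapping.keys (r * q)"
      then obtain i j where "i \<in> Poly_Mapping.keys r" "j \<in> Poly_Mapping.keys q" "k = i + j"
        using keys_mult[of r q] by blast
      then show ?thesis
        using p(3) ge by (simp add: add_less_le_mono)
    qed
  qed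
  have "Poly_Mapping.lookup t (?m + ?n) = 0"
    using t by (metis in_keys_iff less_irrefl)
  then have "?m + ?n \<in> Poly_Mapping.keys (p * q)"
    using p(1) q(1) by (simp add: pq in_keys_iff lookup_add)
  moreover have "?m + ?n \<le> k" if "k \<in> Poly_Mapping.keys (p * q)" for k
  proof -
    have "k \<in> Poly_Mapping.keys (Poly_Mapping.single (?m + ?n) (b * c)) \<or> k \<in> Poly_Mapping.keys t"
      using that keys_add[of "Poly_Mapping.single (?m + ?n) (b * c)" t] unfolding pq by blast
    then show ?thesis
      using t by (auto simp: less_imp_le split: if_splits)
  qed
  ultimately show ?thesis
    unfolding least_exponent_def[of "p * q"] by (intro Min_eqI) auto
qed

lemma is_valuation_least_exponent:
  "is_valuation (least_exponent :: ('g::linordered_ab_group_add \<Rightarrow>\<^sub>0 'b::idom) \<Rightarrow> 'g)"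
  unfolding is_valuation_def
proof (intro conjI allI impI)
  fix p q :: "'g \<Rightarrow>\<^sub>0 'b" and c
  assume "p \<noteq> 0" "q \<noteq> 0" "p + q \<noteq> 0" "c \<le> least_exponent p" "c \<le> least_exponent q"
  then show "c \<le> least_exponent (p + q)"
    using keys_add[of p q] by (fastforce simp: le_least_exponent_iff)
qed (rule least_exponent_mult)

text \<open>
  The extension is \<open>w p - w q\<close> on a fraction of \<open>p\<close> by \<open>q\<close>; multiplicativity makes it independent of
  the representation, and bringing two fractions over a common denominator reduces the ultrametric
  inequality to that of \<open>w\<close>.
\<close>

lemma valuation_extends_to_fractions:
  fixes w :: "'r::idom \<Rightarrow> 'g::ordered_ab_group_add"
  assumes w: "is_valuation w"
  obtains v :: "'r fract \<Rightarrow> 'g"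
  where "is_valuation v" "\<And>p. p \<noteq> 0 \<Longrightarrow> v (Fract p 1) = w p"
proof -
  have wd: "w p - w q = w r - w s"
    if "Fract p q = Fract r s" "p \<noteq> 0" "q \<noteq> 0" "r \<noteq> 0" "s \<noteq> 0" for p q r s
  proof -
    have "w (p * s) = w (r * q)"
      using that by (simp add: eq_fract)
    then have "w p + w s = w r + w q"
      using that is_valuation_mult[OF w] by simp
    then have "w p = w r + w q - w s"
      by (simp add: eq_diff_eq)
    then show ?thesis
      by simp
  qed
  define v where "v x = (THE g. \<exists>p q. p \<noteq> 0 \<and> q \<noteq> 0 \<and> x = Fract p q \<and> g = w p - w q)" for x
  have v: "v (Fract p q) = w p - w q" if "p \<noteq> 0" "q \<noteq> 0" for p q
    unfolding v_def
  proof (rule the_equality)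
    show "\<exists>p' q'. p' \<noteq> 0 \<and> q' \<noteq> 0 \<and> Fract p q = Fract p' q' \<and> w p - w q = w p' - w q'"
      using that by blast
    show "g = w p - w q"
      if "\<exists>p' q'. p' \<noteq> 0 \<and> q' \<noteq> 0 \<and> Fract p q = Fract p' q' \<and> g = w p' - w q'" for g
      using that wd[of p q] \<open>p \<noteq> 0\<close> \<open>q \<noteq> 0\<close> by force
  qed
  have one: "w 1 = 0"
    using is_valuation_mult[OF w, of 1 1] by simp
  have "is_valuation v"
    unfolding is_valuation_def
  proof (intro conjI allI impI)
    fix x y :: "'r fract"
    assume "x \<noteq> 0" "y \<noteq> 0"
    then obtain p q r s where nz: "p \<noteq> 0" "q \<noteq> 0" "r \<noteq> 0" "s \<noteq> 0"
      and x: "x = Fract p q" and y: "y = Fract r s"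
      by (metis Fract_cases_nonzero)
    show "v (x * y) = v x + v y"
      using nz by (simp add: x y v is_valuation_mult[OF w])
    fix c
    assume "x + y \<noteq> 0" and le: "c \<le> v x" "c \<le> v y"
    have sum: "x + y = Fract (p * s + r * q) (q * s)"
      using nz by (simp add: x y)
    with \<open>x + y \<noteq> 0\<close> have nz': "p * s + r * q \<noteq> 0"
      by (auto simp: fract_collapse)
    have "c + w (q * s) \<le> w (p * s)" "c + w (q * s) \<le> w (r * q)"
      using le nz by (simp_all add: x y v is_valuation_mult[OF w] algebra_simps)
    then have "c + w (q * s) \<le> w (p * s + r * q)"
      using is_valuation_add[OF w, of "p * s" "r * q"] nz nz' by simp
    then show "c \<le> v (x + y)"
      using nz nz' by (simp add: sum v le_diff_eq)
  qed
  then show ?thesis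
    using that v one by simp
qed

text \<open>
  The fraction field of a group algebra is a type only if the exponents form a totally ordered group
  by virtue of their type, whereas totality of the order on \<open>'a\<close> is a hypothesis.  The type \<open>'a line\<close>
  is the whole group \<open>'a\<close> if its order is total and the trivial group otherwise; in both cases it
  is totally ordered.
\<close>

typedef (overloaded) 'a line = "{x::'a::ordered_ab_group_add. x = 0 \<or> totally_ordered TYPE('a)}"
  by auto

setup_lifting type_definition_line

instantiation line :: (ordered_ab_group_add) linordered_ab_group_add
begin

lift_definition zero_line :: "'a line" is 0 by simp
lift_definition plus_line :: "'a line \<Rightarrow> 'a line \<Rightarrow> 'a line" is "(+)" by auto
lift_definition uminus_line :: "'a line \<Rightarrow> 'a line" is uminus by auto
lift_definition minus_line :: "'a line \<Rightarrow> 'a line \<Rightarrow> 'a line" is "(-)" by auto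
lift_definition less_eq_line :: "'a line \<Rightarrow> 'a line \<Rightarrow> bool" is "(\<le>)" .
lift_definition less_line :: "'a line \<Rightarrow> 'a line \<Rightarrow> bool" is "(<)" .

instance
proof
  fix x y z :: "'a line"
  show "x + y + z = x + (y + z)" by transfer (rule add.assoc)
  show "x + y = y + x" by transfer (rule add.commute)
  show "0 + x = x" by transfer simp
  show "- x + x = 0" by transfer simp
  show "x - y = x + - y" by transfer simp
  show "x < y \<longleftrightarrow> x \<le> y \<and> \<not> y \<le> x" by transfer (rule less_le_not_le)
  show "x \<le> x" by transfer simp
  show "x \<le> z" if "x \<le> y" "y \<le> z" using that by transfer (rule order_trans)
  show "x = y" if "x \<le> y" "y \<le> x" using that by transfer (rule order_antisym)
  show "z + x \<le> z + y" if "x \<le> y" using that by transfer (rule add_left_mono)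
  show "x \<le> y \<or> y \<le> x" by transfer (auto simp: totally_ordered_def)
qed

end

text \<open>
  \<open>Abs_line\<close> is surjective, so elements of the group algebra can be recorded as functions on \<open>'a\<close>
  itself, the form in which they occur in \<open>'a fraction_universe\<close>.
\<close>

lemma inj_comp_Abs_line:
  "inj (\<lambda>p::'a::ordered_ab_group_add line \<Rightarrow>\<^sub>0 'b::zero. Poly_Mapping.lookup p \<circ> Abs_line)"
proof (rule injI)
  fix p q :: "'a line \<Rightarrow>\<^sub>0 'b"
  assume eq: "Poly_Mapping.lookup p \<circ> Abs_line = Poly_Mapping.lookup q \<circ> Abs_line"
  show "p = q"
  proof (rule poly_mapping_eqI)
    fix g :: "'a line"
    show "Poly_Mapping.lookup p g = Poly_Mapping.lookup q g"
      using fun_cong[OF eq, of "Rep_line g"] by (simp add: Rep_line_inverse)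
  qed
qed

text \<open>
  A fraction is determined by any one of the pairs that represent it, so coding the pairs by an
  injection loses nothing.
\<close>

lemma inj_fractions_as_sets_of_pairs:
  fixes h :: "'r::idom \<Rightarrow> 'b"
  assumes "inj h"
  shows "inj (\<lambda>x. {(h p, h q) | p q. q \<noteq> 0 \<and> x = Fract p q})"
proof (rule injI)
  fix x y :: "'r fract"
  assume eq: "{(h p, h q) | p q. q \<noteq> 0 \<and> x = Fract p q} = {(h p, h q) | p q. q \<noteq> 0 \<and> y = Fract p q}"
  obtain p q where x: "x = Fract p q" "q \<noteq> 0"
    by (cases x)
  then have "(h p, h q) \<in> {(h p, h q) | p q. q \<noteq> 0 \<and> y = Fract p q}"
    unfolding eq[symmetric] by blast
  then show "x = y"
    using x assms by (auto dest: injD)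
qed

text \<open>
  The ring structure on the range of \<open>e\<close> that makes the injection \<open>e\<close> an isomorphism.
\<close>

definition ring_on_range :: "('f::field \<Rightarrow> 'k) \<Rightarrow> 'k ring" where
  "ring_on_range e = \<lparr>carrier = range e, monoid.mult = (\<lambda>x y. e (inv_into UNIV e x * inv_into UNIV e y)), one = e 1,
     ring.zero = e 0, add = (\<lambda>x y. e (inv_into UNIV e x + inv_into UNIV e y))\<rparr>"

lemma ring_on_range_simps:
  assumes "inj e"
  shows "carrier (ring_on_range e) = range e"
    and "\<one>\<^bsub>ring_on_range e\<^esub> = e 1" "\<zero>\<^bsub>ring_on_range e\<^esub> = e 0"
    and "e x \<otimes>\<^bsub>ring_on_range e\<^esub> e y = e (x * y)"
    and "e x \<oplus>\<^bsub>ring_on_range e\<^esub> e y = e (x + y)"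
  using assms by (simp_all add: ring_on_range_def)

lemma field_ring_on_range:
  fixes e :: "'f::field \<Rightarrow> 'k"
  assumes "inj e"
  shows "field (ring_on_range e)"
proof -
  let ?F = "ring_of_type_algebra :: 'f ring"
  have F: "field ?F"
    by (rule field_from_type_algebra)
  have "e \<in> ring_iso ?F (ring_on_range e)"
    using assms by (auto simp: ring_iso_def ring_hom_def bij_betw_def ring_of_type_algebra_def
        ring_on_range_simps)
  from field.ring_iso_imp_img_field[OF F this] show ?thesis
    by (simp add: ring_on_range_def ring_of_type_algebra_def)
qed

section \<open>The group of divisibility of a valuation domain\<close>

text \<open>
  The ultrametric inequality enters with the bound \<open>0\<close>, where it says that the elements of
  nonnegative value are closed under addition.
\<close>

locale surjective_valuation = field K for K :: "'k ring" (structure) +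
  fixes v :: "'k \<Rightarrow> 'a::ordered_ab_group_add"
  assumes v_mult: "x \<in> carrier K - {\<zero>} \<Longrightarrow> y \<in> carrier K - {\<zero>} \<Longrightarrow> v (x \<otimes> y) = v x + v y"
    and v_add: "x \<in> carrier K - {\<zero>} \<Longrightarrow> y \<in> carrier K - {\<zero>} \<Longrightarrow> x \<oplus> y \<noteq> \<zero> \<Longrightarrow>
        0 \<le> v x \<Longrightarrow> 0 \<le> v y \<Longrightarrow> 0 \<le> v (x \<oplus> y)"
    and v_surj: "v ` (carrier K - {\<zero>}) = UNIV"
    and total: "totally_ordered TYPE('a)"
begin

definition ring_of_integers :: "'k set" where
  "ring_of_integers = {x \<in> carrier K. x = \<zero> \<or> 0 \<le> v x}"

lemma v_one: "v \<one> = 0"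
  using v_mult[of \<one> \<one>] by simp

lemma inv_nonzero:
  assumes "x \<in> carrier K - {\<zero>}"
  shows "inv x \<in> carrier K - {\<zero>}" "x \<otimes> inv x = \<one>"
  using assms Units_inv_Units[of x] Units_r_inv[of x] by (simp_all add: field_Units)

lemma v_inv:
  assumes "x \<in> carrier K - {\<zero>}"
  shows "v (inv x) = - v x"
  using v_mult[of x "inv x"] inv_nonzero[OF assms] assms by (simp add: v_one eq_neg_iff_add_eq_0 add.commute)

text \<open>
  The square of \<open>\<ominus> \<one>\<close> has value zero, and a totally ordered group has no element of order two.
\<close>

lemma v_uminus_one: "v (\<ominus> \<one>) = 0"
proof -
  have "v (\<ominus> \<one>) + v (\<ominus> \<one>) = 0"
    using v_mult[of "\<ominus> \<one>" "\<ominus> \<one>"] v_one by (simp add: l_minus r_minus)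
  then have "v (\<ominus> \<one>) = - v (\<ominus> \<one>)"
    by (simp add: eq_neg_iff_add_eq_0)
  moreover have "v (\<ominus> \<one>) \<le> 0 \<or> 0 \<le> v (\<ominus> \<one>)"
    using total by (simp add: totally_ordered_def)
  ultimately show ?thesis
    by (metis neg_0_le_iff_le neg_le_0_iff_le order_antisym)
qed

lemma v_uminus:
  assumes "x \<in> carrier K - {\<zero>}"
  shows "v (\<ominus> x) = v x"
  using v_mult[of "\<ominus> \<one>" x] assms by (simp add: l_minus v_uminus_one)

lemma valuation_domain_ring_of_integers: "valuation_domain K ring_of_integers"
proof -
  have dich: "x \<in> ring_of_integers \<or> inv x \<in> ring_of_integers" if "x \<in> carrier K - {\<zero>}" for x
    using that inv_nonzero[OF that] total
    by (auto simp: ring_of_integers_def v_inv totally_ordered_def)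
  have "subring ring_of_integers K"
  proof (rule subringI)
    fix x y
    assume x: "x \<in> ring_of_integers" and y: "y \<in> ring_of_integers"
    then show "x \<oplus> y \<in> ring_of_integers"
      using v_add[of x y] by (cases "x = \<zero> \<or> y = \<zero>") (auto simp: ring_of_integers_def)
    show "x \<otimes> y \<in> ring_of_integers"
      using x y v_mult[of x y] by (cases "x = \<zero> \<or> y = \<zero>") (auto simp: ring_of_integers_def)
    show "\<ominus> x \<in> ring_of_integers"
      using x v_uminus[of x] by (cases "x = \<zero>") (auto simp: ring_of_integers_def)
  qed (auto simp: ring_of_integers_def v_one)
  then have "subdomain ring_of_integers K"
    by (rule subdomainI')
  moreover have "\<exists>a\<in>ring_of_integers. \<exists>b\<in>ring_of_integers - {\<zero>}. x = a \<otimes> inv b"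
    if x: "x \<in> carrier K" for x
  proof (cases "x \<in> ring_of_integers")
    case True
    moreover have "\<one> \<in> ring_of_integers - {\<zero>}" "x = x \<otimes> inv \<one>"
      using x by (auto simp: ring_of_integers_def v_one)
    ultimately show ?thesis
      by blast
  next
    case False
    then have nz: "x \<in> carrier K - {\<zero>}"
      using x by (auto simp: ring_of_integers_def)
    then have "inv x \<in> ring_of_integers - {\<zero>}"
      using dich False inv_nonzero(1) by blast
    moreover have "\<one> \<in> ring_of_integers" "x = \<one> \<otimes> inv (inv x)"
      using nz by (auto simp: ring_of_integers_def v_one field_Units)
    ultimately show ?thesis
      by blast
  qed
  ultimately show ?thesis
    using dich field_axioms by (simp add: valuation_domain_def quotient_field_def)
qed

lemma group_hom_v: "group_hom (mult_of K) (additive_group :: 'a monoid) v"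
proof -
  have "group (additive_group :: 'a monoid)"
    by (rule groupI) (auto simp: additive_group_def add.assoc intro: exI[of _ "- _"])
  then show ?thesis
    using field_mult_group[unfolded Multiplicative_Group.mult_of_def, folded mult_of_def] v_mult
    by (auto simp: group_hom_def group_hom_axioms_def hom_def additive_group_def)
qed

text \<open>
  If a product of two elements of nonnegative value is \<open>\<one>\<close>, their values add up to zero and hence
  vanish.
\<close>

lemma domain_units_eq_kernel:
  "domain_units K ring_of_integers = kernel (mult_of K) (additive_group :: 'a monoid) v"
proof -
  have "x \<in> domain_units K ring_of_integers \<longleftrightarrow> x \<in> carrier K - {\<zero>} \<and> v x = 0" for x
  proof
    assume "x \<in> domain_units K ring_of_integers"
    then obtain y where xy: "x \<in> ring_of_integers" "y \<in> ring_of_integers" "x \<otimes> y = \<one>"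
      by (auto simp: domain_units_def Units_def)
    then have nz: "x \<in> carrier K - {\<zero>}" "y \<in> carrier K - {\<zero>}"
      by (auto simp: ring_of_integers_def)
    then have "v x + v y = 0" "0 \<le> v x" "0 \<le> v y"
      using xy v_mult[OF nz] by (auto simp: v_one ring_of_integers_def)
    then show "x \<in> carrier K - {\<zero>} \<and> v x = 0"
      using nz by (simp add: add_nonneg_eq_0_iff)
  next
    assume x: "x \<in> carrier K - {\<zero>} \<and> v x = 0"
    then have "inv x \<in> ring_of_integers" "x \<otimes> inv x = \<one>" "x \<in> ring_of_integers"
      using inv_nonzero[of x] v_inv[of x] by (auto simp: ring_of_integers_def)
    moreover have "inv x \<otimes> x = \<one>"
      using calculation m_comm by (auto simp: ring_of_integers_def)
    ultimately show "x \<in> domain_units K ring_of_integers"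
      by (auto simp: domain_units_def Units_def)
  qed
  then show ?thesis
    by (auto simp: kernel_def additive_group_def)
qed

text \<open>
  The homomorphism theorem turns \<open>v\<close> into an isomorphism \<open>\<psi>\<close> from the group of divisibility onto
  \<open>'a\<close>.  Its inverse \<open>\<phi>\<close> sends \<open>v x\<close> to the coset of \<open>x\<close>, and it respects the orders because
  \<open>y \<otimes> inv x\<close> is integral exactly if \<open>v x \<le> v y\<close>.
\<close>

lemma valuation_divisibility_group:
  "valuation_divisibility_group TYPE('a) TYPE('k)"
proof -
  let ?U = "domain_units K ring_of_integers" and ?G = "divisibility_group K ring_of_integers"
  interpret v: group_hom "mult_of K" "additive_group :: 'a monoid" v
    by (rule group_hom_v)
  define \<psi> where "\<psi> S = the_elem (v ` S)" for S
  have iso: "\<psi> \<in> iso ?G (additive_group :: 'a monoid)"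
    using v.FactGroup_iso_set v_surj
    by (simp add: \<psi>_def[abs_def] divisibility_group_def domain_units_eq_kernel additive_group_def)
  have bij: "bij_betw \<psi> (carrier ?G) UNIV"
    using iso by (simp add: iso_def additive_group_def)
  define \<phi> where "\<phi> = inv_into (carrier ?G) \<psi>"
  have coset: "?U #>\<^bsub>mult_of K\<^esub> x \<in> carrier ?G" "\<psi> (?U #>\<^bsub>mult_of K\<^esub> x) = v x"
    if x: "x \<in> carrier K - {\<zero>}" for x
  proof -
    show "?U #>\<^bsub>mult_of K\<^esub> x \<in> carrier ?G"
      using x by (auto simp: divisibility_group_def FactGroup_def RCOSETS_def)
    have "v ` (?U #>\<^bsub>mult_of K\<^esub> x) = {v x}"
    proof -
      have "v (u \<otimes> x) = v x" if "u \<in> ?U" for u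
        using that x v_mult[of u x] by (simp add: domain_units_eq_kernel kernel_def additive_group_def)
      moreover have "\<one> \<in> ?U"
        using v_one by (simp add: domain_units_eq_kernel kernel_def additive_group_def)
      ultimately show ?thesis
        by (auto simp: r_coset_def image_UN)
    qed
    then show "\<psi> (?U #>\<^bsub>mult_of K\<^esub> x) = v x"
      by (simp add: \<psi>_def)
  qed
  have \<phi>: "\<phi> a = ?U #>\<^bsub>mult_of K\<^esub> x \<longleftrightarrow> a = v x" if "x \<in> carrier K - {\<zero>}" for a x
  proof -
    have "\<psi> (\<phi> a) = a"
      using bij by (simp add: \<phi>_def bij_betw_inv_into_right)
    moreover have "\<phi> (\<psi> (?U #>\<^bsub>mult_of K\<^esub> x)) = ?U #>\<^bsub>mult_of K\<^esub> x"
      unfolding \<phi>_def by (rule bij_betw_inv_into_left[OF bij coset(1)[OF that]])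
    ultimately show ?thesis
      using coset(2)[OF that] by auto
  qed
  have "group ?G"
    unfolding divisibility_group_def domain_units_eq_kernel
    by (rule normal.factorgroup_is_group[OF v.normal_kernel])
  then have "\<phi> \<in> iso (additive_group :: 'a monoid) ?G"
    using group.iso_set_sym[OF _ iso] by (simp add: \<phi>_def)
  moreover have "a \<le> b \<longleftrightarrow> divisibility_le K ring_of_integers (\<phi> a) (\<phi> b)" for a b
  proof -
    have quot: "y \<otimes> inv x \<in> ring_of_integers \<longleftrightarrow> v x \<le> v y"
      if "x \<in> carrier K - {\<zero>}" "y \<in> carrier K - {\<zero>}" for x y
      using that inv_nonzero[of x] v_inv[of x] v_mult[of y "inv x"] integral[of y "inv x"]
      by (auto simp: ring_of_integers_def)
    have "divisibility_le K ring_of_integers (\<phi> a) (\<phi> b) \<longleftrightarrow>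
        (\<exists>x\<in>carrier K - {\<zero>}. \<exists>y\<in>carrier K - {\<zero>}. a = v x \<and> b = v y \<and> v x \<le> v y)"
      unfolding divisibility_le_def carrier_mult_of using \<phi> quot by (intro bex_cong refl) simp
    also have "\<dots> \<longleftrightarrow> a \<le> b"
    proof -
      obtain x y where "x \<in> carrier K - {\<zero>}" "y \<in> carrier K - {\<zero>}" "a = v x" "b = v y"
        using v_surj by (metis UNIV_I image_iff)
      then show ?thesis
        by auto
    qed
    finally show ?thesis
      by simp
  qed
  ultimately show ?thesis
    unfolding valuation_divisibility_group_def
    using valuation_domain_ring_of_integers by blast
qed

end

text \<open>
  The valuation by least exponents on the fraction field of the rational group algebra takes every
  value, already on monomials.
\<close>

lemma total_group_is_divisibility_group:
  assumes total: "totally_ordered TYPE('a::ordered_ab_group_add)"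
  shows "valuation_divisibility_group TYPE('a) TYPE('a fraction_universe)"
proof -
  obtain w :: "('a line \<Rightarrow>\<^sub>0 rat) fract \<Rightarrow> 'a line"
    where w: "is_valuation w" "\<And>p. p \<noteq> 0 \<Longrightarrow> w (Fract p 1) = least_exponent p"
    using valuation_extends_to_fractions[OF is_valuation_least_exponent] by blast
  define h :: "('a line \<Rightarrow>\<^sub>0 rat) \<Rightarrow> 'a \<Rightarrow> rat" where "h p = Poly_Mapping.lookup p \<circ> Abs_line" for p
  define e where "e x = {(h p, h q) | p q. q \<noteq> 0 \<and> x = Fract p q}" for x
  have "inj h"
    unfolding h_def[abs_def] by (rule inj_comp_Abs_line)
  then have e: "inj e"
    unfolding e_def[abs_def] by (rule inj_fractions_as_sets_of_pairs)
  let ?K = "ring_on_range e" and ?v = "\<lambda>x. Rep_line (w (inv_into UNIV e x))"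
  have nonzero: "x \<in> carrier ?K - {\<zero>\<^bsub>?K\<^esub>} \<longleftrightarrow> (\<exists>y. x = e y \<and> y \<noteq> 0)" for x
    using e by (auto simp: ring_on_range_simps inj_eq)
  have "surjective_valuation ?K ?v"
  proof (intro surjective_valuation.intro field_ring_on_range[OF e] surjective_valuation_axioms.intro total)
    fix x y
    assume "x \<in> carrier ?K - {\<zero>\<^bsub>?K\<^esub>}" "y \<in> carrier ?K - {\<zero>\<^bsub>?K\<^esub>}"
    then obtain a b where ab: "x = e a" "a \<noteq> 0" "y = e b" "b \<noteq> 0"
      unfolding nonzero by blast
    show "?v (x \<otimes>\<^bsub>?K\<^esub> y) = ?v x + ?v y"
      using ab e is_valuation_mult[OF w(1)] by (simp add: ring_on_range_simps plus_line.rep_eq)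
    assume "x \<oplus>\<^bsub>?K\<^esub> y \<noteq> \<zero>\<^bsub>?K\<^esub>" "0 \<le> ?v x" "0 \<le> ?v y"
    moreover from this have "a + b \<noteq> 0"
      using ab e by (auto simp: ring_on_range_simps)
    ultimately show "0 \<le> ?v (x \<oplus>\<^bsub>?K\<^esub> y)"
      using ab e is_valuation_add[OF w(1), of a b 0]
      by (simp add: ring_on_range_simps less_eq_line.rep_eq zero_line.rep_eq)
  next
    have "\<exists>x\<in>carrier ?K - {\<zero>\<^bsub>?K\<^esub>}. g = ?v x" for g
    proof -
      define p where "p = Poly_Mapping.single (Abs_line g) (1::rat)"
      have "p \<noteq> 0"
        by (metis p_def keys_single keys_zero insert_not_empty one_neq_zero)
      then have "w (Fract p 1) = Abs_line g"
        by (simp add: w(2) p_def least_exponent_single)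
      then have "?v (e (Fract p 1)) = g"
        using e total by (simp add: Abs_line_inverse)
      moreover have "Fract p 1 \<noteq> 0"
        using \<open>p \<noteq> 0\<close> by (simp add: Zero_fract_def eq_fract)
      ultimately show ?thesis
        using nonzero by metis
    qed
    then show "?v ` (carrier ?K - {\<zero>\<^bsub>?K\<^esub>}) = UNIV"
      by blast
  qed
  then show ?thesis
    by (rule surjective_valuation.valuation_divisibility_group)
qed

text \<open>
  Two cosets are comparable since the quotient of representatives, or its inverse, is in the domain.
\<close>

lemma total_if_valuation_divisibility_group:
  assumes "valuation_divisibility_group TYPE('a::{ab_group_add,ord}) TYPE('k)"
  shows "totally_ordered TYPE('a)"
  unfolding totally_ordered_def
proof (intro allI)
  fix a b :: 'a
  obtain K :: "'k ring" and D and \<phi> :: "'a \<Rightarrow> 'k set"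
    where D: "valuation_domain K D"
      and iso: "\<phi> \<in> iso additive_group (divisibility_group K D)"
      and le: "\<And>a b. a \<le> b \<longleftrightarrow> divisibility_le K D (\<phi> a) (\<phi> b)"
    using assms unfolding valuation_divisibility_group_def by blast
  interpret field K
    using D by (simp add: valuation_domain_def quotient_field_def)
  have coset: "\<exists>x\<in>carrier (mult_of K). \<phi> c = domain_units K D #>\<^bsub>mult_of K\<^esub> x" for c
  proof -
    have "\<phi> c \<in> carrier (divisibility_group K D)"
      using iso by (auto simp: iso_def hom_def additive_group_def)
    then show ?thesis
      by (auto simp: divisibility_group_def FactGroup_def RCOSETS_def)
  qed
  obtain x y where x: "x \<in> carrier (mult_of K)" "\<phi> a = domain_units K D #>\<^bsub>mult_of K\<^esub> x"
    and y: "y \<in> carrier (mult_of K)" "\<phi> b = domain_units K D #>\<^bsub>mult_of K\<^esub> y"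
    using coset by blast
  then have units: "x \<in> Units K" "y \<in> Units K"
    by (simp_all add: field_Units)
  then have "y \<otimes>\<^bsub>K\<^esub> inv\<^bsub>K\<^esub> x \<in> Units K"
    by simp
  then have "y \<otimes>\<^bsub>K\<^esub> inv\<^bsub>K\<^esub> x \<in> D \<or> inv\<^bsub>K\<^esub> (y \<otimes>\<^bsub>K\<^esub> inv\<^bsub>K\<^esub> x) \<in> D"
    using D unfolding valuation_domain_def field_Units by blast
  moreover have "inv\<^bsub>K\<^esub> (y \<otimes>\<^bsub>K\<^esub> inv\<^bsub>K\<^esub> x) = x \<otimes>\<^bsub>K\<^esub> inv\<^bsub>K\<^esub> y"
  proof (rule comm_inv_char)
    have "(y \<otimes>\<^bsub>K\<^esub> inv\<^bsub>K\<^esub> x) \<otimes>\<^bsub>K\<^esub> (x \<otimes>\<^bsub>K\<^esub> inv\<^bsub>K\<^esub> y) = y \<otimes>\<^bsub>K\<^esub> (inv\<^bsub>K\<^esub> x \<otimes>\<^bsub>K\<^esub> x) \<otimes>\<^bsub>K\<^esub> inv\<^bsub>K\<^esub> y"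
      using units by (simp add: m_assoc Units_closed del: Units_l_inv)
    then show "(y \<otimes>\<^bsub>K\<^esub> inv\<^bsub>K\<^esub> x) \<otimes>\<^bsub>K\<^esub> (x \<otimes>\<^bsub>K\<^esub> inv\<^bsub>K\<^esub> y) = \<one>\<^bsub>K\<^esub>"
      using units by (simp add: Units_closed)
  qed (use units in \<open>simp_all add: Units_closed\<close>)
  ultimately show "a \<le> b \<or> b \<le> a"
    using x y by (auto simp: le divisibility_le_def)
qed

section \<open>The equivalence\<close>

theorem corollary2p3:
  "tfae
    [\<forall>a::'a::lattice_ordered_division_ring. 0 \<le> a ^ 2,
     \<forall>a b::'a. 0 < a * b \<and> (0 < a \<or> 0 < b) \<longrightarrow> 0 < a \<and> 0 < b,
     \<forall>a b::'a. a \<le> b \<or> b \<le> a,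
     \<forall>a::'a. \<exists>n::nat. 1 \<le> n \<and> 0 \<le> a ^ n,
     \<forall>a b c::'a. inf a b = 0 \<and> 0 \<le> c \<longrightarrow> inf (c * a) b = 0 \<and> inf (a * c) b = 0,
     \<forall>a b::'a. inf a b = 0 \<longrightarrow> a * b = 0,
     valuation_divisibility_group TYPE('a) TYPE('a fraction_universe),
     \<forall>a::'a. 0 < a \<longrightarrow> 0 < inverse a]
   \<and> (valuation_divisibility_group TYPE('a) TYPE('k) \<longrightarrow>
      valuation_divisibility_group TYPE('a) TYPE('a fraction_universe))"
  (is "tfae [?squares, ?closed, ?total, ?powers, ?f_ring, ?almost_f, ?divis, ?inverses] \<and> (?divis_in \<longrightarrow> _)")
proof -
  have total: "?total \<longleftrightarrow> totally_ordered TYPE('a)"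
    by (simp add: totally_ordered_def)
  have chain: "tfae [A, B, C, D, E, F, G, H]"
    if "C \<longrightarrow> A" "C \<longrightarrow> B" "C \<longrightarrow> E" "A \<longrightarrow> D" "D \<longrightarrow> H" "B \<longrightarrow> H" "H \<longrightarrow> C" "E \<longrightarrow> F" "F \<longrightarrow> C"
      "C \<longrightarrow> G" "G \<longrightarrow> C" for A B C D E F G H
  proof -
    have "A = C" "B = C" "D = C" "E = C" "F = C" "G = C" "H = C"
      using that by iprover+
    then show ?thesis
      by (simp add: tfae_def)
  qed
  have "?total \<longrightarrow> ?squares"
    unfolding total by (intro impI allI total_order_consequences(1))
  moreover have "?total \<longrightarrow> ?closed"
    unfolding total by (intro impI allI total_order_consequences(2)) auto
  moreover have "?total \<longrightarrow> ?f_ring"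
    unfolding total by (intro impI allI total_order_consequences(3)) auto
  moreover have "?squares \<longrightarrow> ?powers"
    by (intro impI allI exI[of _ "2::nat"]) simp
  moreover have "?powers \<longrightarrow> ?inverses"
    using positive_inverses_if_positive_power by blast
  moreover have "?closed \<longrightarrow> ?inverses"
    using positive_inverses_if_division_closed by blast
  moreover have "?inverses \<longrightarrow> ?total"
    unfolding total using total_if_positive_inverses by blast
  moreover have "?f_ring \<longrightarrow> ?almost_f"
    using disjoint_product_zero_if_f_ring by blast
  moreover have "?almost_f \<longrightarrow> ?total"
    unfolding total using total_if_disjoint_elements_vanish mult_eq_0_iff by metis
  moreover have to_divis: "?total \<longrightarrow> ?divis"
    unfolding total using total_group_is_divisibility_group by blast
  moreover have "?divis \<longrightarrow> ?total"
    unfolding total using total_if_valuation_divisibility_group by blast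
  ultimately have "tfae [?squares, ?closed, ?total, ?powers, ?f_ring, ?almost_f, ?divis, ?inverses]"
    by (rule chain)
  moreover have "?divis_in \<longrightarrow> ?total"
    unfolding total using total_if_valuation_divisibility_group by blast
  ultimately show ?thesis
    using to_divis by blast
qed

end
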